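(* Let $f$ and $\varphi$ be two quaternion-valued functions defined on a neighborhood of $z^0\in\mathbb{H}$. If both $f$ and $\varphi$ are $\mathbb{H}$-differentiable at $z^0$, then: (1) for every $c\in\mathbb{H}$, both $cf$ and $fc$ are $\mathbb{H}$-differentiable at $z^0$, and $(cf)'(z^0)=c f'(z^0)$ and $(fc)'(z^0)=f'(z^0)c$; (2) $f+\varphi$ is $\mathbb{H}$-differentiable at $z^0$ and $(f+\varphi)'(z^0)=f'(z^0)+\varphi'(z^0)$; (3) the pointwise product $f\varphi$ is $\mathbb{H}$-differentiable at $z^0$ and $(f\varphi)'(z^0)=f'(z^0)\varphi(z^0)+f(z^0)\varphi'(z^0)$.
   Context: $\mathbb{H}$ denotes the algebra of real quaternions with its usual norm $|\cdot|$. A quaternion function $f$ defined on a neighborhood $G\subset\mathbb{H}$ of a point $z^0$ is called $\mathbb{H}$-differentiable at $z^0$ if there exist two (finite or infinite) sequences of quaternions $A_k=A_k(z^0)$, $B_k=B_k(z^0)$ such that $\sum_k A_kB_k$ is finite (converges) and, for $z^0+h\in G$, $$f(z^0+h)-f(z^0)=\sum_k A_k\, h\, B_k+\omega(z^0,h),\qquad \lim_{h\to0}\frac{|\omega(z^0,h)|}{|h|}=0.$$ In this case the quaternion $f'(z^0)=\sum_k A_kB_k$ is called the $\mathbb{H}$-derivative of $f$ at $z^0$. *)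

theory Defs
  imports "HOL-Analysis.Analysis"
begin

text \<open>
  The real quaternions: \<open>Quat a b c d\<close> stands for \<open>a + b i + c j + d k\<close>.
\<close>

datatype quat = Quat (qRe: real) (qI: real) (qJ: real) (qK: real)

lemma quat_eq_iff: "x = y \<longleftrightarrow> qRe x = qRe y \<and> qI x = qI y \<and> qJ x = qJ y \<and> qK x = qK y"
  by (auto intro: quat.expand)

instantiation quat :: ab_group_add
begin

definition "0 = Quat 0 0 0 0"
definition "x + y = Quat (qRe x + qRe y) (qI x + qI y) (qJ x + qJ y) (qK x + qK y)"
definition "- x = Quat (- qRe x) (- qI x) (- qJ x) (- qK x)"
definition "x - y = Quat (qRe x - qRe y) (qI x - qI y) (qJ x - qJ y) (qK x - qK y)"

instance
  by standard
    (simp_all add: quat_eq_iff zero_quat_def plus_quat_def uminus_quat_def minus_quat_def)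

end

instantiation quat :: real_algebra_1
begin

definition "1 = Quat 1 0 0 0"

definition "x * y = Quat
  (qRe x * qRe y - qI x * qI y - qJ x * qJ y - qK x * qK y)
  (qRe x * qI y + qI x * qRe y + qJ x * qK y - qK x * qJ y)
  (qRe x * qJ y - qI x * qK y + qJ x * qRe y + qK x * qI y)
  (qRe x * qK y + qI x * qJ y - qJ x * qI y + qK x * qRe y)"

definition "r *\<^sub>R x = Quat (r * qRe x) (r * qI x) (r * qJ x) (r * qK x)"

instance
  by standard
    (simp_all add: quat_eq_iff zero_quat_def one_quat_def plus_quat_def times_quat_def
      scaleR_quat_def algebra_simps)

end

instantiation quat :: division_ring
begin

definition "inverse x = inverse ((qRe x)\<^sup>2 + (qI x)\<^sup>2 + (qJ x)\<^sup>2 + (qK x)\<^sup>2) *\<^sub>R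
  Quat (qRe x) (- qI x) (- qJ x) (- qK x)"

definition "x div y = x * inverse y" for x y :: quat

instance
proof
  fix x y :: quat
  let ?n = "(qRe x)\<^sup>2 + (qI x)\<^sup>2 + (qJ x)\<^sup>2 + (qK x)\<^sup>2"
  assume "x \<noteq> 0"
  then have nz: "?n \<noteq> 0"
    by (auto simp: quat_eq_iff zero_quat_def add_nonneg_eq_0_iff)
  have eq: "inverse ?n *\<^sub>R Quat ?n 0 0 0 = 1"
    using nz by (simp add: quat_eq_iff one_quat_def scaleR_quat_def)
  have "Quat (qRe x) (- qI x) (- qJ x) (- qK x) * x = Quat ?n 0 0 0"
    and "x * Quat (qRe x) (- qI x) (- qJ x) (- qK x) = Quat ?n 0 0 0"
    by (simp_all add: quat_eq_iff times_quat_def power2_eq_square)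
  then show "inverse x * x = 1" "x * inverse x = 1"
    using eq by (simp_all add: inverse_quat_def)
qed (simp_all add: divide_quat_def inverse_quat_def quat_eq_iff zero_quat_def scaleR_quat_def)

end

instantiation quat :: real_inner
begin

definition "x \<bullet> y = qRe x * qRe y + qI x * qI y + qJ x * qJ y + qK x * qK y"
definition "norm x = sqrt ((qRe x)\<^sup>2 + (qI x)\<^sup>2 + (qJ x)\<^sup>2 + (qK x)\<^sup>2)"
definition "sgn x = x /\<^sub>R norm x" for x :: quat
definition "dist x y = norm (x - y)" for x y :: quat
definition [code del]:
  "uniformity = (INF e\<in>{0<..}. principal {(x :: quat, y). dist x y < e})"
definition [code del]:
  "open U \<longleftrightarrow> (\<forall>x\<in>U. eventually (\<lambda>(x', y). x' = x \<longrightarrow> y \<in> U) uniformity)"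
  for U :: "quat set"

instance
proof
  fix x y z :: quat and r :: real
  show "x \<bullet> y = y \<bullet> x" "(x + y) \<bullet> z = x \<bullet> z + y \<bullet> z" "r *\<^sub>R x \<bullet> y = r * (x \<bullet> y)"
    by (simp_all add: inner_quat_def plus_quat_def scaleR_quat_def algebra_simps)
  show "0 \<le> x \<bullet> x" "norm x = sqrt (x \<bullet> x)"
    by (simp_all add: inner_quat_def norm_quat_def power2_eq_square)
  show "x \<bullet> x = 0 \<longleftrightarrow> x = 0"
    by (simp add: inner_quat_def quat_eq_iff zero_quat_def add_nonneg_eq_0_iff)
qed (simp_all add: sgn_quat_def dist_quat_def uniformity_quat_def open_quat_def)

end

instance quat :: real_normed_div_algebra
proof
  fix x y :: quat
  show "norm (x * y) = norm x * norm y"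
    unfolding norm_quat_def real_sqrt_mult[symmetric]
    by (rule arg_cong[where f = sqrt]) (simp add: times_quat_def, algebra)
qed

text \<open>
  \<open>has_H_derivative f G z D\<close>: the values of \<open>f\<close> on the neighbourhood \<open>G\<close> of \<open>z\<close>
  admit a representation with \<open>D = (\<Sum>k. A k * B k)\<close>. A finite sequence is an infinite one
  extended by zeros. Convergence is that of partial sums, not necessarily absolute, and the
  series \<open>\<Sum>k. A k * h * B k\<close> has to converge for every \<open>h\<close> for which it is used.
  Values of \<open>f\<close> outside \<open>G\<close> are irrelevant.
\<close>

definition has_H_derivative :: "(quat \<Rightarrow> quat) \<Rightarrow> quat set \<Rightarrow> quat \<Rightarrow> quat \<Rightarrow> bool" where
  "has_H_derivative f G z D \<longleftrightarrow>
    z \<in> interior G \<and>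
    (\<exists>(A :: nat \<Rightarrow> quat) (B :: nat \<Rightarrow> quat) (\<omega> :: quat \<Rightarrow> quat).
      (\<lambda>k. A k * B k) sums D \<and>
      (\<forall>h. z + h \<in> G \<longrightarrow>
        summable (\<lambda>k. A k * h * B k) \<and>
        f (z + h) - f z = (\<Sum>k. A k * h * B k) + \<omega> h) \<and>
      ((\<lambda>h. norm (\<omega> h) / norm h) \<longlongrightarrow> 0) (at 0))"

definition H_differentiable :: "(quat \<Rightarrow> quat) \<Rightarrow> quat set \<Rightarrow> quat \<Rightarrow> bool" where
  "H_differentiable f G z \<longleftrightarrow> (\<exists>D. has_H_derivative f G z D)"

text \<open>
  The derivative does not depend on the choice of the sequences: restricting \<open>h\<close> to real
  multiples \<open>t\<close> of \<open>1\<close>, the series becomes \<open>t *\<^sub>R D\<close>, so \<open>D\<close> is the derivative of \<open>f\<close> in the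
  direction \<open>1\<close>.
\<close>

lemma has_H_derivative_imp_vector_derivative:
  assumes "has_H_derivative f G z D"
  shows "((\<lambda>t. f (z + of_real t)) has_vector_derivative D) (at 0)"
proof -
  from assms obtain A B \<omega> where z: "z \<in> interior G" and AB: "(\<lambda>k. A k * B k) sums D"
    and f: "\<And>h. z + h \<in> G \<Longrightarrow> f (z + h) - f z = (\<Sum>k. A k * h * B k) + \<omega> h"
    and \<omega>: "((\<lambda>h. norm (\<omega> h) / norm h) \<longlongrightarrow> 0) (at 0)"
    unfolding has_H_derivative_def by blast
  have lim: "filterlim (of_real :: real \<Rightarrow> quat) (at 0) (at 0)"
    unfolding filterlim_at by (auto intro!: tendsto_eq_intros simp: eventually_at_filter)
  have "((\<lambda>t. z + of_real t) \<longlongrightarrow> z) (at (0::real))"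
    by (auto intro!: tendsto_eq_intros)
  then have "\<forall>\<^sub>F t in at (0::real). z + of_real t \<in> interior G"
    using z by (simp add: topological_tendstoD)
  then have ev: "\<forall>\<^sub>F t in at (0::real). z + of_real t \<in> G"
    by (rule eventually_mono) (use interior_subset in auto)
  have "((\<lambda>t. norm (\<omega> (of_real t)) / norm t) \<longlongrightarrow> 0) (at (0::real))"
    using filterlim_compose[OF \<omega> lim] by simp
  moreover have "\<forall>\<^sub>F t in at (0::real). norm (\<omega> (of_real t)) / norm t =
      norm (f (z + of_real t) - f (z + of_real 0) - (t - 0) *\<^sub>R D) / norm (t - 0)"
    using ev
  proof eventually_elim
    case (elim t)
    have "(\<lambda>k. A k * of_real t * B k) = (\<lambda>k. t *\<^sub>R (A k * B k))"
      by (simp add: of_real_def)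
    then have "(\<Sum>k. A k * of_real t * B k) = t *\<^sub>R D"
      using sums_unique[OF sums_scaleR_right[OF AB, of t]] by simp
    then show ?case using f[OF elim] by simp
  qed
  ultimately have "((\<lambda>t. norm (f (z + of_real t) - f (z + of_real 0) - (t - 0) *\<^sub>R D) / norm (t - 0))
      \<longlongrightarrow> 0) (at (0::real))"
    by (rule Lim_transform_eventually)
  then show ?thesis
    unfolding has_vector_derivative_def has_derivative_iff_norm
    by (simp add: bounded_linear_scaleR_left)
qed

lemma has_H_derivative_unique:
  assumes "has_H_derivative f G z D" "has_H_derivative f G z D'"
  shows "D = D'"
  using assms[THEN has_H_derivative_imp_vector_derivative] by (rule vector_derivative_unique_at)

definition H_deriv :: "(quat \<Rightarrow> quat) \<Rightarrow> quat set \<Rightarrow> quat \<Rightarrow> quat" where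
  "H_deriv f G z = (THE D. has_H_derivative f G z D)"

end

theory Submission
  imports Defs
begin

text \<open>
  The series \<open>\<Sum>k. A k * h * B k\<close> converges for all \<open>h\<close> by scaling \<open>h\<close> into the neighbourhood,
  and its sum is a bounded linear function of \<open>h\<close> because the quaternions are finite-dimensional
  over the reals. So an \<open>\<bbbH>\<close>-derivative amounts to a Frechet derivative of the form
  \<open>h \<mapsto> \<Sum>k. A k * h * B k\<close>, and the usual Frechet rules produce the remainders. The new
  coefficient sequences are scaled ones or, for sums and products, interleavings of two sequences.
\<close>

text \<open>The coefficients are hidden behind the quantifier, while \<open>L\<close> and
  \<open>D\<close> stay visible: \<open>L\<close> can then be handed to the Frechet rules, and the
  pair can be tracked by closure properties. One choice of \<open>A\<close> and \<open>B\<close> has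
  to serve both series.\<close>

definition two_sided_series :: "(quat \<Rightarrow> quat) \<Rightarrow> quat \<Rightarrow> bool" where
  "two_sided_series L D \<longleftrightarrow>
    (\<exists>A B. (\<lambda>k. A k * B k) sums D \<and> (\<forall>h. (\<lambda>k. A k * h * B k) sums L h))"

text \<open>The coordinates in the basis 1, i, j, k are written as inner products because these are
  known to be bounded linear in \<open>h\<close>.\<close>

lemma quat_inner_expansion:
  "h = (h \<bullet> Quat 1 0 0 0) *\<^sub>R Quat 1 0 0 0 + (h \<bullet> Quat 0 1 0 0) *\<^sub>R Quat 0 1 0 0 +
    (h \<bullet> Quat 0 0 1 0) *\<^sub>R Quat 0 0 1 0 + (h \<bullet> Quat 0 0 0 1) *\<^sub>R Quat 0 0 0 1"
  by (simp add: quat_eq_iff inner_quat_def plus_quat_def scaleR_quat_def)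

text \<open>Each term is real-linear in \<open>h\<close>, so expanding \<open>h\<close> in the basis
  termwise expresses \<open>L\<close> through its four basis values. Only sums and real multiples of
  convergent series occur, so conditional convergence suffices.\<close>

lemma two_sided_series_bounded_linear:
  assumes "\<And>h. (\<lambda>k. A k * h * B k) sums L h"
  shows "bounded_linear (L :: quat \<Rightarrow> quat)"
proof -
  let ?M = "\<lambda>h. (h \<bullet> Quat 1 0 0 0) *\<^sub>R L (Quat 1 0 0 0) + (h \<bullet> Quat 0 1 0 0) *\<^sub>R L (Quat 0 1 0 0) +
    (h \<bullet> Quat 0 0 1 0) *\<^sub>R L (Quat 0 0 1 0) + (h \<bullet> Quat 0 0 0 1) *\<^sub>R L (Quat 0 0 0 1)"
  have "(\<lambda>k. A k * h * B k) sums ?M h" for h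
  proof -
    have "A k * h * B k = (h \<bullet> Quat 1 0 0 0) *\<^sub>R (A k * Quat 1 0 0 0 * B k) +
        (h \<bullet> Quat 0 1 0 0) *\<^sub>R (A k * Quat 0 1 0 0 * B k) +
        (h \<bullet> Quat 0 0 1 0) *\<^sub>R (A k * Quat 0 0 1 0 * B k) +
        (h \<bullet> Quat 0 0 0 1) *\<^sub>R (A k * Quat 0 0 0 1 * B k)" for k
      by (subst quat_inner_expansion[of h]) (simp add: distrib_left distrib_right)
    then show ?thesis
      by (simp only:) (intro sums_add sums_scaleR_right assms)
  qed
  then have "L = ?M"
    using assms by (intro ext sums_unique2)
  moreover have "bounded_linear ?M"
    by (intro bounded_linear_add bounded_linear_scaleR_const bounded_linear_inner_left)
  ultimately show ?thesis by simp
qed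

lemma summable_two_sided:
  fixes z :: quat
  assumes "z \<in> interior G"
    and "\<And>h. z + h \<in> G \<Longrightarrow> summable (\<lambda>k. A k * h * B k)"
  shows "summable (\<lambda>k. A k * h * B k)"
proof -
  \<comment> \<open>The one-sided limit makes the scaling factor \<open>t\<close> positive, hence
    invertible.\<close>
  have "((\<lambda>t. z + t *\<^sub>R h) \<longlongrightarrow> z) (at_right (0::real))"
    by (auto intro!: tendsto_eq_intros)
  then have "\<forall>\<^sub>F t in at_right (0::real). z + t *\<^sub>R h \<in> interior G"
    using assms(1) by (simp add: topological_tendstoD)
  moreover have "\<forall>\<^sub>F t in at_right (0::real). t > 0"
    by (rule eventually_at_right_less)
  ultimately have "\<forall>\<^sub>F t in at_right (0::real). t > 0 \<and> z + t *\<^sub>R h \<in> G"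
    by eventually_elim (use interior_subset in auto)
  then obtain t :: real where t: "t > 0" "z + t *\<^sub>R h \<in> G"
    using eventually_happens'[OF trivial_limit_at_right_real] by blast
  \<comment> \<open>Real scalars are central, so the series at \<open>t *\<^sub>R h\<close> is
    \<open>t\<close> times the one at \<open>h\<close>, and \<open>inverse t\<close> recovers the
    latter.\<close>
  then show ?thesis
    using summable_scaleR_right[OF assms(2)[OF t(2)], of "inverse t"] by simp
qed

lemma has_H_derivative_imp_has_derivative:
  assumes "has_H_derivative f G z D"
  obtains L where "z \<in> interior G" "two_sided_series L D" "(f has_derivative L) (at z)"
  using assms unfolding has_H_derivative_def
proof (elim conjE exE)
  fix A B \<omega>
  assume z: "z \<in> interior G" and AB: "(\<lambda>k. A k * B k) sums D"
    and f: "\<forall>h. z + h \<in> G \<longrightarrow> summable (\<lambda>k. A k * h * B k) \<and>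
      f (z + h) - f z = (\<Sum>k. A k * h * B k) + \<omega> h"
    and \<omega>: "((\<lambda>h. norm (\<omega> h) / norm h) \<longlongrightarrow> 0) (at 0)"
  define L where "L h = (\<Sum>k. A k * h * B k)" for h
  have L: "(\<lambda>k. A k * h * B k) sums L h" for h
    unfolding L_def by (rule summable_sums, rule summable_two_sided[OF z]) (simp add: f)
  have "((\<lambda>h. z + h) \<longlongrightarrow> z) (at 0)"
    by (auto intro!: tendsto_eq_intros)
  then have "\<forall>\<^sub>F h in at 0. z + h \<in> interior G"
    using z by (simp add: topological_tendstoD)
  \<comment> \<open>The equation determines \<open>\<omega> h\<close> only where
    \<open>z + h\<close> lies in \<open>G\<close>, which is enough for a limit at 0.\<close>
  then have "\<forall>\<^sub>F h in at 0. norm (\<omega> h) / norm h = norm (f (z + h) - f z - L h) / norm h"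
    by eventually_elim (use interior_subset f in \<open>force simp: L_def\<close>)
  with \<omega> have "((\<lambda>h. norm (f (z + h) - f z - L h) / norm h) \<longlongrightarrow> 0) (at 0)"
    by (rule Lim_transform_eventually)
  then have "(f has_derivative L) (at z)"
    using two_sided_series_bounded_linear[OF L] by (simp add: has_derivative_at)
  moreover have "two_sided_series L D"
    using AB L unfolding two_sided_series_def by (intro exI[of _ A] exI[of _ B]) simp
  ultimately show thesis
    using z that by simp
qed

lemma has_derivative_imp_has_H_derivative:
  assumes z: "z \<in> interior G" and "two_sided_series L D" and f: "(f has_derivative L) (at z)"
  shows "has_H_derivative f G z D"
proof -
  from assms(2) obtain A B where AB: "(\<lambda>k. A k * B k) sums D"
    and L: "\<And>h. (\<lambda>k. A k * h * B k) sums L h"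
    unfolding two_sided_series_def by blast
  have "((\<lambda>h. norm (f (z + h) - f z - L h) / norm h) \<longlongrightarrow> 0) (at 0)"
    using f by (simp add: has_derivative_at)
  moreover have "summable (\<lambda>k. A k * h * B k)" "(\<Sum>k. A k * h * B k) = L h" for h
    using L[of h] by (auto simp: sums_iff)
  \<comment> \<open>Taking the exact linearization error as the remainder makes the required
    equation hold for every \<open>h\<close>.\<close>
  ultimately show ?thesis
    unfolding has_H_derivative_def using z AB
    by (intro conjI exI[of _ A] exI[of _ B] exI[of _ "\<lambda>h. f (z + h) - f z - L h"]) auto
qed

text \<open>By associativity a constant on the left is absorbed into \<open>A\<close>; one on the
  right will go into \<open>B\<close>.\<close>

lemma two_sided_series_mult_left:
  assumes "two_sided_series L D"
  shows "two_sided_series (\<lambda>h. c * L h) (c * D)"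
proof -
  from assms obtain A B where "(\<lambda>k. A k * B k) sums D" "\<And>h. (\<lambda>k. A k * h * B k) sums L h"
    unfolding two_sided_series_def by blast
  then have "(\<lambda>k. (c * A k) * B k) sums (c * D)" "\<And>h. (\<lambda>k. (c * A k) * h * B k) sums (c * L h)"
    by (auto simp: mult.assoc intro: sums_mult)
  then show ?thesis
    unfolding two_sided_series_def by (intro exI[of _ "\<lambda>k. c * A k"] exI[of _ B]) auto
qed

lemma two_sided_series_mult_right:
  assumes "two_sided_series L D"
  shows "two_sided_series (\<lambda>h. L h * c) (D * c)"
proof -
  from assms obtain A B where "(\<lambda>k. A k * B k) sums D" "\<And>h. (\<lambda>k. A k * h * B k) sums L h"
    unfolding two_sided_series_def by blast
  then have "(\<lambda>k. A k * (B k * c)) sums (D * c)" "\<And>h. (\<lambda>k. A k * h * (B k * c)) sums (L h * c)"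
    by (auto simp: mult.assoc[symmetric] intro: sums_mult2)
  then show ?thesis
    unfolding two_sided_series_def by (intro exI[of _ A] exI[of _ "\<lambda>k. B k * c"]) auto
qed

text \<open>Padding a series with zeros at the positions of one parity keeps its sum, by reindexing
  along \<open>2 * n\<close> or \<open>2 * n + 1\<close>. The two padded series are then added,
  which avoids any rearrangement and so any need for absolute convergence.\<close>

lemma sums_interleave:
  fixes f g :: "nat \<Rightarrow> 'a::real_normed_vector"
  assumes "f sums x" "g sums y"
  shows "(\<lambda>n. if even n then f (n div 2) else g (n div 2)) sums (x + y)"
proof -
  have "(\<lambda>n. if even n then f (n div 2) else 0) sums x"
  proof (rule sums_mono_reindex[THEN iffD1])
    show "strict_mono (\<lambda>n::nat. 2 * n)"
      by (simp add: strict_mono_def)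
    show "(if even n then f (n div 2) else 0) = 0" if "n \<notin> range (\<lambda>n. 2 * n)" for n
      using that by (auto elim: evenE)
  qed (simp add: assms)
  moreover have "(\<lambda>n. if even n then 0 else g (n div 2)) sums y"
  proof (rule sums_mono_reindex[THEN iffD1])
    show "strict_mono (\<lambda>n::nat. 2 * n + 1)"
      by (simp add: strict_mono_def)
    show "(if even n then 0 else g (n div 2)) = 0" if "n \<notin> range (\<lambda>n. 2 * n + 1)" for n
      using that by (auto elim: oddE)
  qed (simp add: assms)
  ultimately have "(\<lambda>n. (if even n then f (n div 2) else 0) + (if even n then 0 else g (n div 2)))
      sums (x + y)"
    by (rule sums_add)
  then show ?thesis
    by (rule sums_cong[THEN iffD1, rotated]) simp
qed

lemma two_sided_series_add:
  assumes "two_sided_series L D" "two_sided_series M E"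
  shows "two_sided_series (\<lambda>h. L h + M h) (D + E)"
proof -
  from assms(1) obtain A B where AB: "(\<lambda>k. A k * B k) sums D" "\<And>h. (\<lambda>k. A k * h * B k) sums L h"
    unfolding two_sided_series_def by blast
  from assms(2) obtain A' B'
    where AB': "(\<lambda>k. A' k * B' k) sums E" "\<And>h. (\<lambda>k. A' k * h * B' k) sums M h"
    unfolding two_sided_series_def by blast
  \<comment> \<open>Left and right coefficients are interleaved by the same parity, so no mixed
    terms \<open>A k * h * B' k\<close> arise.\<close>
  let ?mix = "\<lambda>(X :: nat \<Rightarrow> quat) X' k. if even k then X (k div 2) else X' (k div 2)"
  have "(\<lambda>k. ?mix A A' k * ?mix B B' k) sums (D + E)"
    using sums_interleave[OF AB(1) AB'(1)] by (rule sums_cong[THEN iffD1, rotated]) simp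
  moreover have "(\<lambda>k. ?mix A A' k * h * ?mix B B' k) sums (L h + M h)" for h
    using sums_interleave[OF AB(2) AB'(2)] by (rule sums_cong[THEN iffD1, rotated]) simp
  ultimately show ?thesis
    unfolding two_sided_series_def by (intro exI[of _ "?mix A A'"] exI[of _ "?mix B B'"]) auto
qed

text \<open>The Frechet rule for a constant factor controls the remainder, and the closure property
  of two-sided series supplies the coefficients.\<close>

lemma has_H_derivative_mult_left:
  assumes "has_H_derivative f G z D"
  shows "has_H_derivative (\<lambda>x. c * f x) G z (c * D)"
  using assms by (elim has_H_derivative_imp_has_derivative)
    (rule has_derivative_imp_has_H_derivative, auto intro: two_sided_series_mult_left has_derivative_mult_right)

lemma has_H_derivative_mult_right:
  assumes "has_H_derivative f G z D"
  shows "has_H_derivative (\<lambda>x. f x * c) G z (D * c)"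
  using assms by (elim has_H_derivative_imp_has_derivative)
    (rule has_derivative_imp_has_H_derivative, auto intro: two_sided_series_mult_right has_derivative_mult_left)

lemma has_H_derivative_add:
  assumes "has_H_derivative f G z D" "has_H_derivative g G z E"
  shows "has_H_derivative (\<lambda>x. f x + g x) G z (D + E)"
  using assms by (elim has_H_derivative_imp_has_derivative)
    (rule has_derivative_imp_has_H_derivative, auto intro: two_sided_series_add has_derivative_add)

lemma has_H_derivative_mult:
  assumes "has_H_derivative f G z D" "has_H_derivative g G z E"
  shows "has_H_derivative (\<lambda>x. f x * g x) G z (D * g z + f z * E)"
proof -
  from assms obtain L M where z: "z \<in> interior G"
    and L: "two_sided_series L D" "(f has_derivative L) (at z)"
    and M: "two_sided_series M E" "(g has_derivative M) (at z)"
    by (metis has_H_derivative_imp_has_derivative)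
  \<comment> \<open>In the Leibniz formula the fixed values \<open>g z\<close> and
    \<open>f z\<close> stand outside the series, on the right and left respectively, so each summand
    is again a two-sided series.\<close>
  have "two_sided_series (\<lambda>h. L h * g z + f z * M h) (D * g z + f z * E)"
    by (intro two_sided_series_add two_sided_series_mult_left two_sided_series_mult_right L M)
  moreover have "((\<lambda>x. f x * g x) has_derivative (\<lambda>h. L h * g z + f z * M h)) (at z)"
    using has_derivative_mult[OF L(2) M(2)] by (simp add: add.commute)
  ultimately show ?thesis
    by (rule has_derivative_imp_has_H_derivative[OF z])
qed

text \<open>Uniqueness of the derivative resolves the definite description.\<close>

lemma H_deriv_eqI: "has_H_derivative f G z D \<Longrightarrow> H_deriv f G z = D"
  unfolding H_deriv_def by (blast intro: has_H_derivative_unique)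

lemma has_H_derivative_H_deriv:
  assumes "H_differentiable f G z"
  shows "has_H_derivative f G z (H_deriv f G z)"
  using assms H_deriv_eqI unfolding H_differentiable_def by blast

lemma has_H_derivativeD:
  assumes "has_H_derivative f G z D"
  shows "H_differentiable f G z \<and> H_deriv f G z = D"
  using assms H_deriv_eqI unfolding H_differentiable_def by blast

theorem proposition3p1:
  fixes f \<phi> :: "quat \<Rightarrow> quat" and G :: "quat set" and z0 :: quat
  assumes "z0 \<in> interior G"
    and "H_differentiable f G z0"
    and "H_differentiable \<phi> G z0"
  shows "(\<forall>c. H_differentiable (\<lambda>z. c * f z) G z0 \<and>
              H_deriv (\<lambda>z. c * f z) G z0 = c * H_deriv f G z0 \<and>
              H_differentiable (\<lambda>z. f z * c) G z0 \<and>
              H_deriv (\<lambda>z. f z * c) G z0 = H_deriv f G z0 * c) \<and>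
         (H_differentiable (\<lambda>z. f z + \<phi> z) G z0 \<and>
          H_deriv (\<lambda>z. f z + \<phi> z) G z0 = H_deriv f G z0 + H_deriv \<phi> G z0) \<and>
         (H_differentiable (\<lambda>z. f z * \<phi> z) G z0 \<and>
          H_deriv (\<lambda>z. f z * \<phi> z) G z0 = H_deriv f G z0 * \<phi> z0 + f z0 * H_deriv \<phi> G z0)"
proof -
  note f = has_H_derivative_H_deriv[OF assms(2)] and \<phi> = has_H_derivative_H_deriv[OF assms(3)]
  show ?thesis
    using has_H_derivative_mult_left[OF f, THEN has_H_derivativeD]
      has_H_derivative_mult_right[OF f, THEN has_H_derivativeD]
      has_H_derivative_add[OF f \<phi>, THEN has_H_derivativeD]
      has_H_derivative_mult[OF f \<phi>, THEN has_H_derivativeD]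
    by blast
qed

end
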